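(* Let $T$ be a non-zero contraction on a Hilbert space $\mathcal{H}$ and let $X\in\mathcal{B}(\mathcal{H})$ be such that $TX=qXT$, where $q$ is a complex number with $0<|q|\leq \frac{1}{\|T\|}$. Suppose $V$ on $\mathcal{K}'\supseteq\mathcal{H}$ is the minimal co-isometric extension of $T$, and $V_q$ is an operator on $\mathcal{K}\supseteq\mathcal{H}$ such that $qV_q$ is the minimal co-isometric extension of $qT$. Then there exists an operator $Y\in\mathcal{B}(\mathcal{K},\mathcal{K}')$ such that $$VY=qYV_q,\quad Y(\mathcal{H})\subseteq\mathcal{H},\quad Y|_{\mathcal{H}}=X,\quad \|X\|=\|Y\|.$$
   Context: All operators are bounded and linear and act on complex Hilbert spaces; $\mathcal{B}(\mathcal{K},\mathcal{K}')$ denotes the bounded operators from $\mathcal{K}$ to $\mathcal{K}'$, and $\mathcal{B}(\mathcal{H})=\mathcal{B}(\mathcal{H},\mathcal{H})$. A contraction is an operator of norm at most $1$. A co-isometric extension of a contraction $T$ on $\mathcal{H}$ is a co-isometry $V$ (i.e. $VV^*=I$) on a Hilbert space $\mathcal{K}$ containing $\mathcal{H}$ as a closed subspace such that $V\mathcal{H}\subseteq\mathcal{H}$ and $V|_{\mathcal{H}}=T$. It is minimal if $\mathcal{K}$ is the closed linear span of $\{V^{*n}h : h\in\mathcal{H},\ n\geq 0\}$; the minimal co-isometric extension is unique up to isomorphism. *)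

theory Defs
  imports "HOL-Analysis.Analysis"
begin

text \<open>Complex inner product spaces, built over real ones so that norm, topology and completeness
  are those of the underlying real space. Inner products are linear in the first argument.\<close>

class complex_inner = real_inner +
  fixes scaleC :: "complex \<Rightarrow> 'a \<Rightarrow> 'a" (infixr "*\<^sub>C" 75)
    and cinner :: "'a \<Rightarrow> 'a \<Rightarrow> complex"
  assumes scaleC_add_right: "c *\<^sub>C (x + y) = c *\<^sub>C x + c *\<^sub>C y"
    and scaleC_add_left: "(c + d) *\<^sub>C x = c *\<^sub>C x + d *\<^sub>C x"
    and scaleC_scaleC: "c *\<^sub>C d *\<^sub>C x = (c * d) *\<^sub>C x"
    and scaleR_scaleC: "r *\<^sub>R x = complex_of_real r *\<^sub>C x"
    and cinner_commute: "cinner x y = cnj (cinner y x)"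
    and cinner_add_left: "cinner (x + y) z = cinner x z + cinner y z"
    and cinner_scaleC_left: "cinner (c *\<^sub>C x) y = c * cinner x y"
    and inner_eq_Re_cinner: "inner x y = Re (cinner x y)"

class chilbert_space = complex_inner + complete_space

subclass (in chilbert_space) banach ..

lemma cinner_self: "cinner x x = complex_of_real ((norm x)\<^sup>2)"
  using cinner_commute[of x x]
  by (simp add: complex_eq_iff power2_norm_eq_inner inner_eq_Re_cinner)

global_interpretation complex_vector: vector_space "scaleC :: complex \<Rightarrow> 'a \<Rightarrow> 'a::complex_inner"
  defines cspan = complex_vector.span
proof
  show "1 *\<^sub>C x = x" for x :: 'a
    using scaleR_scaleC[of 1 x] by simp
qed (simp_all add: scaleC_add_right scaleC_add_left scaleC_scaleC)

instantiation complex :: chilbert_space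
begin

definition "scaleC c x = c * x" for c x :: complex
definition "cinner x y = x * cnj y" for x y :: complex

instance
  by standard
    (simp_all add: scaleC_complex_def cinner_complex_def algebra_simps inner_complex_def
      scaleR_conv_of_real)

end

definition bounded_clinear :: "('a::complex_inner \<Rightarrow> 'b::complex_inner) \<Rightarrow> bool" where
  "bounded_clinear f \<longleftrightarrow> bounded_linear f \<and> (\<forall>c x. f (c *\<^sub>C x) = c *\<^sub>C f x)"

definition contraction :: "('a::complex_inner \<Rightarrow> 'b::complex_inner) \<Rightarrow> bool" where
  "contraction T \<longleftrightarrow> bounded_clinear T \<and> onorm T \<le> 1"

text \<open>The Hilbert space adjoint, for bounded operators; the identity determines it uniquely.\<close>

definition cadjoint :: "('a::chilbert_space \<Rightarrow> 'b::chilbert_space) \<Rightarrow> 'b \<Rightarrow> 'a" where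
  "cadjoint V = (THE W. \<forall>x y. cinner (V x) y = cinner x (W y))"

definition coisometry :: "('a::chilbert_space \<Rightarrow> 'b::chilbert_space) \<Rightarrow> bool" where
  "coisometry V \<longleftrightarrow> bounded_clinear V \<and> V \<circ> cadjoint V = id"

text \<open>A Hilbert space containing another one as a closed subspace is rendered by an embedding
  preserving the linear structure and the inner product; its range is closed by completeness.\<close>

definition hilbert_embedding :: "('h::chilbert_space \<Rightarrow> 'k::chilbert_space) \<Rightarrow> bool" where
  "hilbert_embedding J \<longleftrightarrow>
     bounded_clinear J \<and> (\<forall>x y. cinner (J x) (J y) = cinner x y)"

definition coisometric_extension ::
  "('h::chilbert_space \<Rightarrow> 'k::chilbert_space) \<Rightarrow> ('h \<Rightarrow> 'h) \<Rightarrow> ('k \<Rightarrow> 'k) \<Rightarrow> bool" where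
  "coisometric_extension J T V \<longleftrightarrow>
     hilbert_embedding J \<and> contraction T \<and> coisometry V \<and>
     V ` range J \<subseteq> range J \<and> (\<forall>h. V (J h) = J (T h))"

definition minimal_coisometric_extension ::
  "('h::chilbert_space \<Rightarrow> 'k::chilbert_space) \<Rightarrow> ('h \<Rightarrow> 'h) \<Rightarrow> ('k \<Rightarrow> 'k) \<Rightarrow> bool" where
  "minimal_coisometric_extension J T V \<longleftrightarrow>
     coisometric_extension J T V \<and>
     closure (cspan {(cadjoint V ^^ n) (J h) | n h. True}) = UNIV"

end

theory Submission
  imports Defs
begin

text \<open>
  Put \<open>S = q T\<close> and \<open>W = q V\<^sub>q\<close>. The hypothesis on \<open>X\<close> says \<open>T X = X S\<close>, so with \<open>J'\<close> the embedding
  of the space of \<open>T\<close> into that of \<open>V\<close>, the operator \<open>Z = J' X\<close> satisfies \<open>V Z = Z S\<close>, and what is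
  wanted is an operator \<open>Y\<close> with \<open>V Y = Y W\<close> that extends \<open>Z\<close> without increasing the norm. This is
  the commutant lifting theorem, written for extensions of operators instead of dilations of their
  adjoints; \<open>intertwining_lift\<close> proves it.

  Let \<open>M\<^sub>n\<close> be the space of the vectors that \<open>W\<^sup>n\<close> sends into the embedded space. These spaces increase,
  \<open>W\<close> maps \<open>M\<^sub>n\<^sub>+\<^sub>1\<close> into \<open>M\<^sub>n\<close>, and minimality of \<open>W\<close> makes their union dense, because \<open>W\<^sup>n\<close> undoes \<open>n\<close>
  applications of the adjoint of \<open>W\<close>. The operator is extended from each \<open>M\<^sub>n\<close> to the next. Suppose that
  \<open>A\<close> has norm at most \<open>K\<close> and that \<open>V A = A W\<close> holds on \<open>M\<^sub>n\<close>. The next operator \<open>B\<close> should agree with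
  \<open>A\<close> on \<open>M\<^sub>n\<close> and satisfy \<open>V B = A W\<close>. The second requirement says that the component of \<open>B\<close>
  orthogonal to the kernel of \<open>V\<close> is \<open>R = V\<^sup>* A W\<close>, and on \<open>M\<^sub>n\<close> the component in the kernel has to be
  \<open>C = A - R\<close>. By Pythagoras, a norm bound \<open>K\<close> for \<open>B\<close> means that the kernel component is dominated by
  the form \<open>D x y = K\<^sup>2 \<langle>x, y\<rangle> - \<langle>R x, R y\<rangle>\<close>, which is positive semidefinite since \<open>R\<close> has norm at most
  \<open>K\<close>. So the step (\<open>intertwining_extension_step\<close>) amounts to extending \<open>C\<close> from a subspace while
  keeping it dominated by \<open>D\<close>. That is \<open>extension_dominated\<close>: compose \<open>C\<close> with the orthogonal
  projection onto the subspace with respect to \<open>D\<close>.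

  Such a projection lives only in the completion of the space modulo the kernel of \<open>D\<close>. Approximate
  projections inside the subspace replace it: the values of \<open>C\<close> on them form a Cauchy sequence in the
  complete target space. They come from a single minimisation argument, \<open>near_representer_exists\<close>,
  which also gives the Riesz representation theorem, and with it the existence of adjoints.
\<close>

section \<open>Positive semidefinite forms\<close>

text \<open>This discriminant bound serves both the Cauchy-Schwarz inequality and the first-order condition
  at a near minimum of a quadratic functional. The case \<open>b = 0\<close> occurs, since forms may be degenerate.\<close>

lemma nonneg_quadratic_imp_abs_le:
  fixes a b c :: real
  assumes "0 \<le> b" "0 \<le> c" and nonneg: "\<And>t. 0 \<le> c + 2 * t * a + t\<^sup>2 * b"
  shows "\<bar>a\<bar> \<le> sqrt c * sqrt b"
proof -
  have "a\<^sup>2 \<le> c * b"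
  proof (cases "b = 0")
    case True
    have "a = 0"
    proof (rule ccontr)
      assume "a \<noteq> 0"
      then show False
        using nonneg[of "- (c + 1) / (2 * a)"] True by (simp add: field_simps)
    qed
    then show ?thesis using True by simp
  next
    case False
    then have "0 < b" using assms by simp
    then show ?thesis
      using nonneg[of "- a / b"] by (simp add: field_simps power2_eq_square)
  qed
  then have "sqrt (a\<^sup>2) \<le> sqrt (c * b)" by (rule real_sqrt_le_mono)
  then show ?thesis by (simp add: real_sqrt_mult)
qed

locale positive_semidefinite_form =
  fixes D :: "'a::real_vector \<Rightarrow> 'a \<Rightarrow> real"
  assumes add_left: "D (x + y) z = D x z + D y z"
    and scaleR_left: "D (r *\<^sub>R x) z = r * D x z"
    and sym: "D x y = D y x"
    and nonneg: "0 \<le> D x x"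
begin

lemma add_right: "D z (x + y) = D z x + D z y"
  using add_left sym by metis

lemma scaleR_right: "D z (r *\<^sub>R x) = r * D z x"
  using scaleR_left sym by metis

lemma diff_left: "D (x - y) z = D x z - D y z"
  using add_left[of "x - y" y z] by simp

lemma linear_right: "linear (D e)"
  by (rule linearI) (simp_all add: add_right scaleR_right)

definition seminorm :: "'a \<Rightarrow> real" where
  "seminorm x = sqrt (D x x)"

lemma seminorm_nonneg: "0 \<le> seminorm x"
  by (simp add: seminorm_def nonneg)

lemma seminorm_square: "(seminorm x)\<^sup>2 = D x x"
  by (simp add: seminorm_def nonneg)

lemma Cauchy_Schwarz: "\<bar>D x y\<bar> \<le> seminorm x * seminorm y"
  unfolding seminorm_def
proof (rule nonneg_quadratic_imp_abs_le)
  show "0 \<le> D x x + 2 * t * D x y + t\<^sup>2 * D y y" for t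
    using nonneg[of "x + t *\<^sub>R y"] sym[of y x]
    by (simp add: add_left add_right scaleR_left scaleR_right power2_eq_square algebra_simps)
qed (rule nonneg)+

text \<open>The functional \<open>f\<close> agrees on \<open>F\<close> with \<open>D x\<close> up to an error of dual seminorm at most \<open>\<epsilon>\<close>. When
  \<open>f\<close> is \<open>D e\<close>, such an \<open>x\<close> is an approximate \<open>D\<close>-orthogonal projection of \<open>e\<close> onto \<open>F\<close>.\<close>

definition near_representer :: "'a set \<Rightarrow> ('a \<Rightarrow> real) \<Rightarrow> real \<Rightarrow> 'a \<Rightarrow> bool" where
  "near_representer F f \<epsilon> x \<longleftrightarrow> x \<in> F \<and> (\<forall>h\<in>F. \<bar>f h - D x h\<bar> \<le> \<epsilon> * seminorm h)"

text \<open>An exact representer would minimise \<open>D x x - 2 f x\<close> over \<open>F\<close>. The infimum is finite because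
  \<open>f\<close> is bounded, but nothing here is complete, so it need not be attained. A point within \<open>\<epsilon>\<^sup>2\<close> of it
  represents \<open>f\<close> up to \<open>\<epsilon>\<close>: moving from the point along \<open>h\<close> cannot lower the functional by more than
  \<open>\<epsilon>\<^sup>2\<close>, which limits its derivative along \<open>h\<close>.\<close>

lemma near_representer_exists:
  assumes F: "subspace F" and f: "linear f"
    and bound: "\<And>h. h \<in> F \<Longrightarrow> \<bar>f h\<bar> \<le> K * seminorm h" and "0 < \<epsilon>"
  shows "\<exists>x. near_representer F f \<epsilon> x"
proof -
  define E where "E x = D x x - 2 * f x" for x
  have lower: "- K\<^sup>2 \<le> E x" if "x \<in> F" for x
  proof -
    have "0 \<le> (seminorm x - K)\<^sup>2" by simp
    also have "\<dots> = D x x - 2 * (K * seminorm x) + K\<^sup>2"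
      by (simp add: power2_diff seminorm_square algebra_simps)
    also have "\<dots> \<le> E x + K\<^sup>2" using bound[OF that] by (simp add: E_def)
    finally show ?thesis by simp
  qed
  then have bdd: "bdd_below (E ` F)" by (rule bdd_belowI2)
  have "E ` F \<noteq> {}" using subspace_0[OF F] by blast
  moreover have "Inf (E ` F) < Inf (E ` F) + \<epsilon>\<^sup>2" using \<open>0 < \<epsilon>\<close> by simp
  ultimately obtain x where x: "x \<in> F" "E x < Inf (E ` F) + \<epsilon>\<^sup>2"
    using cInf_lessD[of "E ` F" "Inf (E ` F) + \<epsilon>\<^sup>2"] by auto
  have "\<bar>f h - D x h\<bar> \<le> \<epsilon> * seminorm h" if h: "h \<in> F" for h
  proof -
    have "\<bar>D x h - f h\<bar> \<le> sqrt (\<epsilon>\<^sup>2) * sqrt (D h h)"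
    proof (rule nonneg_quadratic_imp_abs_le)
      fix t
      have "x + t *\<^sub>R h \<in> F" using F x h by (simp add: subspace_add subspace_scale)
      then have "Inf (E ` F) \<le> E (x + t *\<^sub>R h)" using bdd by (simp add: cInf_lower)
      then have "E x - \<epsilon>\<^sup>2 \<le> E (x + t *\<^sub>R h)" using x by simp
      also have "\<dots> = E x + 2 * t * (D x h - f h) + t\<^sup>2 * D h h"
        by (simp add: E_def add_left add_right scaleR_left scaleR_right sym[of h x]
            linear_add[OF f] linear_scale[OF f] power2_eq_square algebra_simps)
      finally show "0 \<le> \<epsilon>\<^sup>2 + 2 * t * (D x h - f h) + t\<^sup>2 * D h h" by simp
    qed (simp_all add: nonneg)
    then show ?thesis using \<open>0 < \<epsilon>\<close> by (simp add: seminorm_def abs_minus_commute)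
  qed
  then show ?thesis using x by (auto simp: near_representer_def)
qed

text \<open>Test both approximate identities on \<open>h = x - y\<close>. This replaces uniqueness of the representer.\<close>

lemma near_representers_close:
  assumes F: "subspace F" and x: "near_representer F f \<epsilon> x" and y: "near_representer F f \<delta> y"
    and "0 \<le> \<epsilon>" "0 \<le> \<delta>"
  shows "seminorm (x - y) \<le> \<epsilon> + \<delta>"
proof -
  let ?d = "x - y"
  have d: "?d \<in> F" using F x y by (simp add: near_representer_def subspace_diff)
  have "seminorm ?d * seminorm ?d = (f ?d - D y ?d) - (f ?d - D x ?d)"
    by (simp add: diff_left flip: seminorm_square power2_eq_square)
      (simp add: seminorm_square diff_left)
  also have "\<dots> \<le> \<bar>f ?d - D y ?d\<bar> + \<bar>f ?d - D x ?d\<bar>" by linarith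
  also have "\<dots> \<le> \<delta> * seminorm ?d + \<epsilon> * seminorm ?d"
    using x y d unfolding near_representer_def by (intro add_mono) blast+
  finally have "seminorm ?d * seminorm ?d \<le> (\<epsilon> + \<delta>) * seminorm ?d"
    by (simp add: algebra_simps)
  then show ?thesis
    using seminorm_nonneg[of ?d] assms(4,5) by (cases "seminorm ?d = 0") auto
qed

end

lemma LIMSEQ_inverse_Suc: "(\<lambda>n. 1 / real (Suc n)) \<longlonglongrightarrow> 0"
  using LIMSEQ_inverse_real_of_nat by (simp add: inverse_eq_divide)

lemma Cauchy_of_dist_le_add:
  fixes X :: "nat \<Rightarrow> 'a::metric_space"
  assumes "\<delta> \<longlonglongrightarrow> (0::real)" and "\<And>m n. dist (X m) (X n) \<le> \<delta> m + \<delta> n"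
  shows "Cauchy X"
proof (rule metric_CauchyI)
  fix e :: real assume "0 < e"
  then have "\<forall>\<^sub>F n in sequentially. \<delta> n < e / 2"
    using assms(1) by (intro order_tendstoD) auto
  then obtain M where M: "\<And>n. M \<le> n \<Longrightarrow> \<delta> n < e / 2"
    by (auto simp: eventually_sequentially)
  have "dist (X m) (X n) < e" if "M \<le> m" "M \<le> n" for m n
    using assms(2)[of m n] M[OF that(1)] M[OF that(2)] by linarith
  then show "\<exists>M. \<forall>m\<ge>M. \<forall>n\<ge>M. dist (X m) (X n) < e" by blast
qed

interpretation inner_form: positive_semidefinite_form "inner :: 'a::real_inner \<Rightarrow> 'a \<Rightarrow> real"
  by unfold_locales (simp_all add: inner_add_left, rule inner_commute)

lemma inner_seminorm_eq_norm: "inner_form.seminorm x = norm x"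
  by (simp add: inner_form.seminorm_def norm_eq_sqrt_inner)

lemma Riesz_representation:
  fixes f :: "'a::{real_inner, complete_space} \<Rightarrow> real"
  assumes "bounded_linear f"
  shows "\<exists>z. \<forall>x. f x = inner z x"
proof -
  interpret f: bounded_linear f by fact
  obtain K where K: "\<And>h. \<bar>f h\<bar> \<le> K * norm h"
    using f.bounded by (auto simp: mult.commute)
  have "\<exists>x. inner_form.near_representer UNIV f (1 / real (Suc n)) x" for n
    by (rule inner_form.near_representer_exists[where K = K])
      (use K in \<open>auto simp: inner_seminorm_eq_norm f.linear_axioms\<close>)
  then obtain x where x: "\<And>n. inner_form.near_representer UNIV f (1 / real (Suc n)) (x n)"
    by metis
  have "Cauchy x"
    using inner_form.near_representers_close[OF subspace_UNIV x x]
    by (intro Cauchy_of_dist_le_add[OF LIMSEQ_inverse_Suc]) (simp add: dist_norm inner_seminorm_eq_norm)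
  then obtain z where z: "x \<longlonglongrightarrow> z" using Cauchy_convergent convergent_def by blast
  have "f h = inner z h" for h
  proof -
    have "(\<lambda>n. \<bar>f h - inner (x n) h\<bar>) \<longlonglongrightarrow> \<bar>f h - inner z h\<bar>"
      by (intro tendsto_intros z)
    moreover have "(\<lambda>n. 1 / real (Suc n) * norm h) \<longlonglongrightarrow> 0"
      using tendsto_mult_right[OF LIMSEQ_inverse_Suc] by simp
    ultimately have "\<bar>f h - inner z h\<bar> \<le> 0"
      using x by (intro LIMSEQ_le) (auto simp: inner_form.near_representer_def inner_seminorm_eq_norm)
    then show ?thesis by simp
  qed
  then show ?thesis by blast
qed

section \<open>Adjoints and co-isometries\<close>

lemma bounded_clinear_bounded_linear: "bounded_clinear f \<Longrightarrow> bounded_linear f"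
  by (simp add: bounded_clinear_def)

lemma bounded_clinear_scaleC: "bounded_clinear f \<Longrightarrow> f (c *\<^sub>C x) = c *\<^sub>C f x"
  by (simp add: bounded_clinear_def)

lemma bounded_clinear_add: "bounded_clinear f \<Longrightarrow> f (x + y) = f x + f y"
  by (simp add: bounded_clinear_def linear_add bounded_linear.linear)

lemma bounded_clinear_compose:
  "bounded_clinear f \<Longrightarrow> bounded_clinear g \<Longrightarrow> bounded_clinear (\<lambda>x. f (g x))"
  by (simp add: bounded_clinear_def bounded_linear_compose)

lemma bounded_clinearI:
  assumes "\<And>x y. f (x + y) = f x + f y" and scale: "\<And>c x. f (c *\<^sub>C x) = c *\<^sub>C f x"
    and "\<And>x. norm (f x) \<le> K * norm x"
  shows "bounded_clinear f"
  unfolding bounded_clinear_def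
  using assms by (auto intro!: bounded_linear_intro[where K = K] simp: scaleR_scaleC mult.commute)

lemma complex_subspace_imp_subspace:
  "complex_vector.subspace F \<Longrightarrow> subspace F"
  by (simp add: complex_vector.subspace_def subspace_def scaleR_scaleC)

lemma inner_scaleC_left: "inner (c *\<^sub>C x) y = inner x (cnj c *\<^sub>C y)"
proof -
  have "cinner x (cnj c *\<^sub>C y) = c * cinner x y"
    using cinner_commute[of x "cnj c *\<^sub>C y"] cinner_commute[of y x]
    by (simp add: cinner_scaleC_left)
  then show ?thesis by (simp add: inner_eq_Re_cinner cinner_scaleC_left)
qed

lemma norm_scaleC: "norm (c *\<^sub>C x) = cmod c * norm (x :: 'a::complex_inner)"
proof -
  have "(norm (c *\<^sub>C x))\<^sup>2 = inner x ((cnj c * c) *\<^sub>C x)"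
    by (simp add: power2_norm_eq_inner inner_scaleC_left scaleC_scaleC)
  also have "cnj c * c = complex_of_real ((cmod c)\<^sup>2)"
    by (metis complex_norm_square mult.commute)
  finally have "(norm (c *\<^sub>C x))\<^sup>2 = (cmod c * norm x)\<^sup>2"
    by (simp add: power_mult_distrib power2_norm_eq_inner flip: scaleR_scaleC)
  then show ?thesis by (simp add: power2_eq_iff_nonneg)
qed

text \<open>The adjoint is specified by a definite description, so its existence has to be shown. Riesz
  representation is applied to the real inner product; the imaginary part follows by replacing \<open>x\<close>
  with \<open>- \<i> x\<close>.\<close>

lemma cinner_cadjoint:
  fixes V :: "'a::chilbert_space \<Rightarrow> 'b::chilbert_space"
  assumes V: "bounded_clinear V"
  shows "cinner (V x) y = cinner x (cadjoint V y)"
proof -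
  interpret V: bounded_linear V by (rule bounded_clinear_bounded_linear[OF V])
  have "\<exists>z. \<forall>x. inner (V x) y = inner z x" for y
    using Riesz_representation[of "\<lambda>x. inner (V x) y"]
      bounded_linear_compose[OF bounded_linear_inner_left V.bounded_linear_axioms] by blast
  then obtain W where W: "\<And>x y. inner (V x) y = inner (W y) x" by metis
  have W': "cinner (V x) y = cinner x (W y)" for x y
  proof (rule complex_eqI)
    show "Re (cinner (V x) y) = Re (cinner x (W y))"
      using W[of x y] by (simp add: inner_commute flip: inner_eq_Re_cinner)
    have "inner (- \<i> *\<^sub>C V x) y = inner (- \<i> *\<^sub>C x) (W y)"
      using W[of "- \<i> *\<^sub>C x" y]
      by (simp only: bounded_clinear_scaleC[OF V] inner_commute[of "W y"])
    then show "Im (cinner (V x) y) = Im (cinner x (W y))"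
      by (simp add: inner_eq_Re_cinner cinner_scaleC_left del: complex_vector.scale_minus_left)
  qed
  have "cadjoint V = W"
    unfolding cadjoint_def
  proof (rule the_equality)
    fix W2 assume W2: "\<forall>x y. cinner (V x) y = cinner x (W2 y)"
    have "W2 y = W y" for y
    proof -
      have "inner x (W2 y) = inner x (W y)" for x
        using W2 W' by (simp add: inner_eq_Re_cinner)
      then show ?thesis by (metis inner_commute vector_eq_rdot)
    qed
    then show "W2 = W" by blast
  qed (use W' in blast)
  then show ?thesis using W' by simp
qed

lemma inner_cadjoint:
  "bounded_clinear V \<Longrightarrow> inner (V x) y = inner x (cadjoint V y)"
  by (simp add: inner_eq_Re_cinner cinner_cadjoint)

context
  fixes V :: "'a::chilbert_space \<Rightarrow> 'b::chilbert_space"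
  assumes V: "coisometry V"
begin

lemma coisometry_bounded_clinear: "bounded_clinear V"
  using V by (simp add: coisometry_def)

lemma coisometry_cadjoint_cancel: "V (cadjoint V y) = y"
  using V by (simp add: coisometry_def comp_def fun_eq_iff)

lemma coisometry_norm_cadjoint: "norm (cadjoint V y) = norm y"
  using inner_cadjoint[OF coisometry_bounded_clinear, of "cadjoint V y" y]
  by (simp add: coisometry_cadjoint_cancel norm_eq_sqrt_inner)

lemma coisometry_norm_le: "norm (V x) \<le> norm x"
proof -
  have "norm (V x) * norm (V x) = inner x (cadjoint V (V x))"
    using inner_cadjoint[OF coisometry_bounded_clinear, of x "V x"]
    by (simp add: power2_eq_square flip: power2_norm_eq_inner)
  also have "\<dots> \<le> norm x * norm (V x)"
    using norm_cauchy_schwarz[of x "cadjoint V (V x)"] by (simp add: coisometry_norm_cadjoint)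
  finally show ?thesis by (cases "norm (V x) = 0") auto
qed

lemma coisometry_bounded_clinear_cadjoint: "bounded_clinear (cadjoint V)"
proof (rule bounded_clinearI[where K = 1])
  note adj = inner_cadjoint[OF coisometry_bounded_clinear, symmetric]
  fix x y :: 'b and c :: complex
  have "inner z (cadjoint V (x + y)) = inner z (cadjoint V x + cadjoint V y)" for z
    by (simp add: adj inner_add_right)
  then show "cadjoint V (x + y) = cadjoint V x + cadjoint V y"
    by (metis inner_commute vector_eq_rdot)
  have "inner z (cadjoint V (c *\<^sub>C x)) = inner z (c *\<^sub>C cadjoint V x)" for z
    using inner_scaleC_left[of "cnj c" z "cadjoint V x"] inner_scaleC_left[of "cnj c" "V z" x]
    by (simp add: adj bounded_clinear_scaleC[OF coisometry_bounded_clinear, symmetric])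
  then show "cadjoint V (c *\<^sub>C x) = c *\<^sub>C cadjoint V x"
    by (metis inner_commute vector_eq_rdot)
qed (simp add: coisometry_norm_cadjoint)

end

section \<open>Extending operators dominated by a form\<close>

locale complex_positive_semidefinite_form =
  positive_semidefinite_form D for D :: "'a::complex_inner \<Rightarrow> 'a \<Rightarrow> real" +
  assumes scaleC_left: "D (c *\<^sub>C x) y = D x (cnj c *\<^sub>C y)"
begin

lemma seminorm_scaleC: "seminorm (c *\<^sub>C x) = cmod c * seminorm x"
proof -
  have "D (c *\<^sub>C x) (c *\<^sub>C x) = D x (complex_of_real ((cmod c)\<^sup>2) *\<^sub>C x)"
    unfolding scaleC_left scaleC_scaleC complex_norm_square by (simp only: mult.commute)
  also have "\<dots> = (cmod c)\<^sup>2 * D x x"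
    by (simp only: scaleR_right scaleR_scaleC[symmetric])
  finally show ?thesis by (simp add: seminorm_def real_sqrt_mult)
qed

lemma near_representer_add:
  assumes F: "subspace F" and "near_representer F (D x) \<epsilon> u" "near_representer F (D y) \<delta> v"
  shows "near_representer F (D (x + y)) (\<epsilon> + \<delta>) (u + v)"
proof -
  have "\<bar>D (x + y) h - D (u + v) h\<bar> \<le> (\<epsilon> + \<delta>) * seminorm h" if "h \<in> F" for h
  proof -
    have "\<bar>D x h - D u h\<bar> \<le> \<epsilon> * seminorm h" "\<bar>D y h - D v h\<bar> \<le> \<delta> * seminorm h"
      using assms that by (auto simp: near_representer_def)
    then show ?thesis unfolding add_left distrib_right by linarith
  qed
  then show ?thesis using assms by (simp add: near_representer_def subspace_add)
qed

lemma near_representer_scaleC: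
  assumes F: "complex_vector.subspace F" and u: "near_representer F (D x) \<epsilon> u"
  shows "near_representer F (D (c *\<^sub>C x)) (\<epsilon> * cmod c) (c *\<^sub>C u)"
proof -
  have "\<bar>D (c *\<^sub>C x) h - D (c *\<^sub>C u) h\<bar> \<le> \<epsilon> * cmod c * seminorm h" if "h \<in> F" for h
  proof -
    have "cnj c *\<^sub>C h \<in> F" using F that by (rule complex_vector.subspace_scale)
    then have "\<bar>D x (cnj c *\<^sub>C h) - D u (cnj c *\<^sub>C h)\<bar> \<le> \<epsilon> * seminorm (cnj c *\<^sub>C h)"
      using u by (auto simp: near_representer_def)
    then show ?thesis by (simp add: scaleC_left seminorm_scaleC mult.assoc)
  qed
  then show ?thesis
    using u complex_vector.subspace_scale[OF F] by (simp add: near_representer_def)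
qed

text \<open>The extension is \<open>C\<close> composed with the \<open>D\<close>-orthogonal projection onto \<open>F\<close>, which is why it is
  still dominated by \<open>D\<close>. Since this projection exists only after completion, \<open>C' e\<close> is defined as the
  limit of \<open>C\<close> along near representers of \<open>D e\<close> in \<open>F\<close>. Domination of \<open>C\<close> on \<open>F\<close> makes the values of
  \<open>C\<close> along any two such sequences draw together; hence the limit does not depend on the sequence
  (\<open>C'_eqI\<close> in the proof), and linearity follows by adding and scaling the sequences. As the limits
  are limits of values of \<open>C\<close>, the closed range condition comes for free; it keeps an extension of a
  map into a closed subspace inside that subspace.\<close>

lemma extension_dominated:
  fixes C :: "'a \<Rightarrow> 'b::chilbert_space"
  assumes F: "complex_vector.subspace F"
    and C_add: "\<And>x y. x \<in> F \<Longrightarrow> y \<in> F \<Longrightarrow> C (x + y) = C x + C y"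
    and C_scale: "\<And>c x. x \<in> F \<Longrightarrow> C (c *\<^sub>C x) = c *\<^sub>C C x"
    and C_le: "\<And>x. x \<in> F \<Longrightarrow> (norm (C x))\<^sup>2 \<le> D x x"
    and D_le: "\<And>x. D x x \<le> (K * norm x)\<^sup>2" and "0 \<le> K"
  shows "\<exists>C'. bounded_clinear C' \<and> (\<forall>x\<in>F. C' x = C x) \<and>
           (\<forall>x. (norm (C' x))\<^sup>2 \<le> D x x) \<and> range C' \<subseteq> closure (C ` F)"
proof -
  have F': "subspace F" by (rule complex_subspace_imp_subspace[OF F])
  have C_le': "norm (C x) \<le> seminorm x" if "x \<in> F" for x
    using C_le[OF that] by (simp add: seminorm_def real_le_rsqrt)
  have C_diff: "C (x - y) = C x - C y" if "x \<in> F" "y \<in> F" for x y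
    using C_add[of "x - y" y] that F' by (simp add: subspace_diff)
  have "\<exists>x. near_representer F (D e) (1 / real (Suc n)) x" for e n
    by (rule near_representer_exists[where K = "seminorm e"])
      (auto simp: F' linear_right Cauchy_Schwarz)
  then obtain p where p: "\<And>e n. near_representer F (D e) (1 / real (Suc n)) (p e n)"
    by metis
  have pF: "p e n \<in> F" for e n using p by (simp add: near_representer_def)
  have close: "dist (C u) (C v) \<le> \<epsilon> + \<delta>"
    if "near_representer F (D e) \<epsilon> u" "near_representer F (D e) \<delta> v" "0 \<le> \<epsilon>" "0 \<le> \<delta>" for e u v \<epsilon> \<delta>
  proof -
    have uv: "u \<in> F" "v \<in> F" using that by (auto simp: near_representer_def)
    then have "dist (C u) (C v) = norm (C (u - v))" by (simp add: dist_norm C_diff)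
    also have "\<dots> \<le> seminorm (u - v)" using uv F' by (intro C_le') (simp add: subspace_diff)
    also have "\<dots> \<le> \<epsilon> + \<delta>" using near_representers_close[OF F'] that by blast
    finally show ?thesis .
  qed
  have "Cauchy (\<lambda>n. C (p e n))" for e
    by (rule Cauchy_of_dist_le_add[OF LIMSEQ_inverse_Suc]) (rule close[OF p p], simp_all)
  then have "\<exists>g. (\<lambda>n. C (p e n)) \<longlonglongrightarrow> g" for e
    using Cauchy_convergent convergent_def by blast
  then obtain C' where C': "\<And>e. (\<lambda>n. C (p e n)) \<longlonglongrightarrow> C' e" by metis
  have C'_eqI: "C' e = g"
    if u: "\<And>n. near_representer F (D e) (\<delta> n) (u n)" and "\<And>n. 0 \<le> \<delta> n" and "\<delta> \<longlonglongrightarrow> 0"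
      and g: "(\<lambda>n. C (u n)) \<longlonglongrightarrow> g" for e u g and \<delta> :: "nat \<Rightarrow> real"
  proof -
    have "(\<lambda>n. 1 / real (Suc n) + \<delta> n) \<longlonglongrightarrow> 0 + 0"
      by (intro tendsto_add LIMSEQ_inverse_Suc that)
    moreover have "(\<lambda>n. dist (C (p e n)) (C (u n))) \<longlonglongrightarrow> dist (C' e) g"
      by (intro tendsto_dist C' g)
    moreover have "dist (C (p e n)) (C (u n)) \<le> 1 / real (Suc n) + \<delta> n" for n
      by (rule close[OF p u]) (simp_all add: that)
    ultimately have "dist (C' e) g \<le> 0 + 0" by (intro LIMSEQ_le) auto
    then show ?thesis by simp
  qed
  have C'_add: "C' (x + y) = C' x + C' y" for x y
  proof (rule C'_eqI)
    show "near_representer F (D (x + y)) (1 / real (Suc n) + 1 / real (Suc n)) (p x n + p y n)" for n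
      by (intro near_representer_add F' p)
    show "(\<lambda>n. 1 / real (Suc n) + 1 / real (Suc n)) \<longlonglongrightarrow> 0"
      using tendsto_add[OF LIMSEQ_inverse_Suc LIMSEQ_inverse_Suc] by simp
    show "(\<lambda>n. C (p x n + p y n)) \<longlonglongrightarrow> C' x + C' y"
      using tendsto_add[OF C' C'] by (simp add: C_add pF)
  qed simp
  have C'_scale: "C' (c *\<^sub>C x) = c *\<^sub>C C' x" for c x
  proof (rule C'_eqI)
    show "near_representer F (D (c *\<^sub>C x)) (1 / real (Suc n) * cmod c) (c *\<^sub>C p x n)" for n
      by (intro near_representer_scaleC F p)
    show "(\<lambda>n. 1 / real (Suc n) * cmod c) \<longlonglongrightarrow> 0"
      using tendsto_mult_right[OF LIMSEQ_inverse_Suc] by simp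
    have "bounded_linear (\<lambda>x::'b. c *\<^sub>C x)"
      by (rule bounded_linear_intro[where K = "cmod c"])
        (simp_all add: scaleC_add_right scaleR_scaleC scaleC_scaleC mult.commute norm_scaleC)
    from bounded_linear.tendsto[OF this C'] show "(\<lambda>n. C (c *\<^sub>C p x n)) \<longlonglongrightarrow> c *\<^sub>C C' x"
      by (simp add: C_scale pF)
  qed simp
  have C'_ext: "C' x = C x" if "x \<in> F" for x
    by (rule C'_eqI[where \<delta> = "\<lambda>_. 0" and u = "\<lambda>_. x"])
      (use that in \<open>simp_all add: near_representer_def\<close>)
  \<comment> \<open>a near representer of \<open>D x\<close> is at most slightly longer than \<open>x\<close>, as projections shrink\<close>
  have C'_le: "norm (C' x) \<le> seminorm x" for x
  proof -
    have "norm (C (p x n)) \<le> seminorm x + 1 / real (Suc n)" for n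
    proof -
      let ?u = "p x n"
      have "seminorm ?u * seminorm ?u = D x ?u - (D x ?u - D ?u ?u)"
        by (simp flip: power2_eq_square seminorm_square)
      also have "\<dots> \<le> \<bar>D x ?u\<bar> + \<bar>D x ?u - D ?u ?u\<bar>" by linarith
      also have "\<dots> \<le> seminorm x * seminorm ?u + 1 / real (Suc n) * seminorm ?u"
        using p[of x n] by (intro add_mono Cauchy_Schwarz) (auto simp: near_representer_def)
      finally have "seminorm ?u * seminorm ?u \<le> (seminorm x + 1 / real (Suc n)) * seminorm ?u"
        by (simp add: distrib_right)
      moreover have "0 \<le> seminorm x + 1 / real (Suc n)" by (simp add: seminorm_nonneg)
      ultimately have "seminorm ?u \<le> seminorm x + 1 / real (Suc n)"
        using seminorm_nonneg[of ?u] by (cases "seminorm ?u = 0") auto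
      then show ?thesis using C_le'[OF pF, of x n] by linarith
    qed
    moreover have "(\<lambda>n. seminorm x + 1 / real (Suc n)) \<longlonglongrightarrow> seminorm x + 0"
      by (intro tendsto_add tendsto_const LIMSEQ_inverse_Suc)
    ultimately have "norm (C' x) \<le> seminorm x + 0"
      by (intro LIMSEQ_le[OF tendsto_norm[OF C']]) auto
    then show ?thesis by simp
  qed
  have C'_le2: "(norm (C' x))\<^sup>2 \<le> D x x" for x
    using power_mono[OF C'_le, of x 2] by (simp add: seminorm_square)
  have "norm (C' x) \<le> K * norm x" for x
    by (rule power2_le_imp_le[OF order_trans[OF C'_le2 D_le]]) (simp add: \<open>0 \<le> K\<close>)
  then have "bounded_clinear C'" by (intro bounded_clinearI C'_add C'_scale)
  moreover have "C' x \<in> closure (C ` F)" for x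
    using C'[of x] pF by (auto simp: closure_sequential intro!: exI[of _ "\<lambda>n. C (p x n)"])
  ultimately show ?thesis using C'_ext C'_le2 by blast
qed

end

lemma bounded_extension:
  fixes C :: "'a::complex_inner \<Rightarrow> 'b::chilbert_space"
  assumes F: "complex_vector.subspace F"
    and C_add: "\<And>x y. x \<in> F \<Longrightarrow> y \<in> F \<Longrightarrow> C (x + y) = C x + C y"
    and C_scale: "\<And>c x. x \<in> F \<Longrightarrow> C (c *\<^sub>C x) = c *\<^sub>C C x"
    and C_le: "\<And>x. x \<in> F \<Longrightarrow> norm (C x) \<le> K * norm x" and K: "0 \<le> K"
  shows "\<exists>C'. bounded_clinear C' \<and> (\<forall>x\<in>F. C' x = C x) \<and> (\<forall>x. norm (C' x) \<le> K * norm x)"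
proof -
  interpret complex_positive_semidefinite_form "\<lambda>x y :: 'a. K\<^sup>2 * inner x y"
    by unfold_locales
      (simp_all add: inner_add_left inner_scaleC_left distrib_left, simp add: inner_commute)
  have sq: "K\<^sup>2 * inner x x = (K * norm x)\<^sup>2" for x :: 'a
    by (simp add: power_mult_distrib power2_norm_eq_inner)
  have "\<exists>C'. bounded_clinear C' \<and> (\<forall>x\<in>F. C' x = C x) \<and>
           (\<forall>x. (norm (C' x))\<^sup>2 \<le> K\<^sup>2 * inner x x) \<and> range C' \<subseteq> closure (C ` F)"
    by (rule extension_dominated[OF F C_add C_scale _ _ K])
      (simp_all only: sq order_refl power_mono[OF C_le norm_ge_zero])
  moreover have "norm u \<le> K * norm x" if "(norm u)\<^sup>2 \<le> K\<^sup>2 * inner x x" for u :: 'b and x :: 'a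
    by (rule power2_le_imp_le) (use that K in \<open>simp_all add: sq\<close>)
  ultimately show ?thesis by blast
qed

section \<open>Lifting intertwining operators\<close>

text \<open>The requirement \<open>V B = A W\<close> forces \<open>B = R + C'\<close> with \<open>R = V\<^sup>* A W\<close> and \<open>C'\<close> taking values in the
  kernel of \<open>V\<close>, and agreement with \<open>A\<close> forces \<open>C' = A - R\<close> on \<open>M\<close>; the hypothesis on \<open>M\<close> says that
  \<open>A - R\<close> does map \<open>M\<close> into the kernel. The ranges of \<open>R\<close> and \<open>C'\<close> are orthogonal, so the bound on
  \<open>B\<close> is exactly domination of \<open>C'\<close> by the form left over from \<open>R\<close>. The identity \<open>V B = A W\<close> is
  obtained on the whole space; it becomes \<open>V B = B W\<close> at each vector that \<open>W\<close> maps into \<open>M\<close>.\<close>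

lemma intertwining_extension_step:
  fixes V :: "'b::chilbert_space \<Rightarrow> 'b" and W :: "'a::complex_inner \<Rightarrow> 'a" and A :: "'a \<Rightarrow> 'b"
  assumes V: "coisometry V"
    and W: "bounded_clinear W" and W_le: "\<And>x. norm (W x) \<le> norm x"
    and M: "complex_vector.subspace M"
    and A: "bounded_clinear A" and A_le: "\<And>x. norm (A x) \<le> K * norm x" and K: "0 \<le> K"
    and VA: "\<And>x. x \<in> M \<Longrightarrow> V (A x) = A (W x)"
  shows "\<exists>B. bounded_clinear B \<and> (\<forall>x\<in>M. B x = A x) \<and>
           (\<forall>x. norm (B x) \<le> K * norm x) \<and> (\<forall>x. V (B x) = A (W x))"
proof -
  note V_lin = coisometry_bounded_clinear[OF V]
  define R where "R x = cadjoint V (A (W x))" for x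
  have R: "bounded_clinear R"
    unfolding R_def
    by (intro bounded_clinear_compose[OF coisometry_bounded_clinear_cadjoint[OF V]]
        bounded_clinear_compose[OF A] W)
  have VR: "V (R x) = A (W x)" for x
    by (simp add: R_def coisometry_cadjoint_cancel[OF V])
  have R_le: "norm (R x) \<le> K * norm x" for x
    using order_trans[OF A_le mult_left_mono[OF W_le K]]
    by (simp add: R_def coisometry_norm_cadjoint[OF V])
  have orth: "(norm (R x + z))\<^sup>2 = (norm (R x))\<^sup>2 + (norm z)\<^sup>2" if "V z = 0" for x z
  proof -
    have "inner z (R x) = 0"
      using inner_cadjoint[OF V_lin, of z "A (W x)"] that by (simp add: R_def)
    then show ?thesis
      by (simp add: power2_norm_eq_inner inner_add_left inner_add_right inner_commute)
  qed
  interpret complex_positive_semidefinite_form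
    "\<lambda>x y. K\<^sup>2 * inner x y - inner (R x) (R y)"
  proof
    fix x y z :: 'a and r :: real and c :: complex
    show "K\<^sup>2 * inner (x + y) z - inner (R (x + y)) (R z)
        = K\<^sup>2 * inner x z - inner (R x) (R z) + (K\<^sup>2 * inner y z - inner (R y) (R z))"
      by (simp add: bounded_clinear_add[OF R] inner_add_left algebra_simps)
    show "K\<^sup>2 * inner (r *\<^sub>R x) z - inner (R (r *\<^sub>R x)) (R z)
        = r * (K\<^sup>2 * inner x z - inner (R x) (R z))"
      using linear_scale[OF bounded_linear.linear[OF bounded_clinear_bounded_linear[OF R]], of r x]
      by (simp add: algebra_simps)
    show "K\<^sup>2 * inner x y - inner (R x) (R y) = K\<^sup>2 * inner y x - inner (R y) (R x)"
      by (simp add: inner_commute)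
    show "0 \<le> K\<^sup>2 * inner x x - inner (R x) (R x)"
      using power_mono[OF R_le, of x 2]
      by (simp add: power_mult_distrib flip: power2_norm_eq_inner)
    show "K\<^sup>2 * inner (c *\<^sub>C x) y - inner (R (c *\<^sub>C x)) (R y)
        = K\<^sup>2 * inner x (cnj c *\<^sub>C y) - inner (R x) (R (cnj c *\<^sub>C y))"
      by (simp add: bounded_clinear_scaleC[OF R] inner_scaleC_left)
  qed
  define C where "C x = A x - R x" for x
  have C: "V (C x) = 0" if "x \<in> M" for x
    using linear_diff[OF bounded_linear.linear[OF bounded_clinear_bounded_linear[OF V_lin]]]
    by (simp add: C_def VA[OF that] VR)
  have "\<exists>C'. bounded_clinear C' \<and> (\<forall>x\<in>M. C' x = C x) \<and>
      (\<forall>x. (norm (C' x))\<^sup>2 \<le> K\<^sup>2 * inner x x - inner (R x) (R x)) \<and> range C' \<subseteq> closure (C ` M)"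
  proof (rule extension_dominated[OF M _ _ _ _ K])
    fix x y :: 'a and c :: complex
    show "C (x + y) = C x + C y"
      by (simp add: C_def bounded_clinear_add[OF A] bounded_clinear_add[OF R])
    show "C (c *\<^sub>C x) = c *\<^sub>C C x"
      by (simp add: C_def bounded_clinear_scaleC[OF A] bounded_clinear_scaleC[OF R]
          complex_vector.scale_right_diff_distrib)
    show "K\<^sup>2 * inner x x - inner (R x) (R x) \<le> (K * norm x)\<^sup>2"
      by (simp add: power_mult_distrib power2_norm_eq_inner)
    show "(norm (C x))\<^sup>2 \<le> K\<^sup>2 * inner x x - inner (R x) (R x)" if "x \<in> M"
      using orth[OF C[OF that], of x] power_mono[OF A_le norm_ge_zero, of x 2]
      by (simp add: C_def power_mult_distrib flip: power2_norm_eq_inner)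
  qed
  then obtain C' where C': "bounded_clinear C'" "\<And>x. x \<in> M \<Longrightarrow> C' x = C x"
      "\<And>x. (norm (C' x))\<^sup>2 \<le> K\<^sup>2 * inner x x - inner (R x) (R x)" "range C' \<subseteq> closure (C ` M)"
    by blast
  have "closed {z. V z = 0}"
    using linear_continuous_on[OF bounded_clinear_bounded_linear[OF V_lin], of UNIV]
    by (intro closed_Collect_eq) auto
  then have "closure (C ` M) \<subseteq> {z. V z = 0}"
    using C by (intro closure_minimal) auto
  then have VC': "V (C' x) = 0" for x using C'(4) by blast
  have le: "norm (R x + C' x) \<le> K * norm x" for x
  proof (rule power2_le_imp_le)
    show "(norm (R x + C' x))\<^sup>2 \<le> (K * norm x)\<^sup>2"
      using C'(3)[of x] by (simp add: orth[OF VC'] power_mult_distrib flip: power2_norm_eq_inner)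
  qed (simp add: K)
  have "bounded_clinear (\<lambda>x. R x + C' x)"
    by (rule bounded_clinearI[OF _ _ le])
      (simp_all add: bounded_clinear_add[OF R] bounded_clinear_add[OF C'(1)]
        bounded_clinear_scaleC[OF R] bounded_clinear_scaleC[OF C'(1)] scaleC_add_right)
  moreover have "V (R x + C' x) = A (W x)" for x
    by (simp add: bounded_clinear_add[OF V_lin] VR VC')
  moreover have "R x + C' x = A x" if "x \<in> M" for x
    by (simp add: C'(2)[OF that] C_def)
  ultimately show ?thesis using le by (intro exI[of _ "\<lambda>x. R x + C' x"]) blast
qed

lemma subspace_vimage:
  assumes f: "bounded_clinear f" and F: "complex_vector.subspace F"
  shows "complex_vector.subspace (f -` F)"
  using complex_vector.subspace_0[OF F] complex_vector.subspace_add[OF F]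
    complex_vector.subspace_scale[OF F]
    linear_0[OF bounded_linear.linear[OF bounded_clinear_bounded_linear[OF f]]]
  by (auto simp: complex_vector.subspace_def bounded_clinear_add[OF f] bounded_clinear_scaleC[OF f])

lemma subspace_range:
  assumes f: "bounded_clinear f"
  shows "complex_vector.subspace (range f)"
  using linear_0[OF bounded_linear.linear[OF bounded_clinear_bounded_linear[OF f]]]
  by (auto simp: complex_vector.subspace_def image_iff simp flip: bounded_clinear_add[OF f]
      bounded_clinear_scaleC[OF f] intro: exI[of _ 0])

lemma bounded_clinear_funpow:
  fixes f :: "'a::complex_inner \<Rightarrow> 'a"
  assumes "bounded_clinear f" shows "bounded_clinear (f ^^ n)"
proof (induction n)
  case 0
  then show ?case by (simp add: bounded_clinear_def id_def bounded_linear_ident)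
next
  case (Suc n)
  then show ?case using bounded_clinear_compose[OF assms Suc] by (simp add: comp_def)
qed

lemma hilbert_embedding_norm: "hilbert_embedding J \<Longrightarrow> norm (J x) = norm x"
  by (simp add: hilbert_embedding_def norm_eq_sqrt_inner inner_eq_Re_cinner)

text \<open>Commutant lifting for the co-isometric extension \<open>W\<close> of \<open>S\<close>. The operators constructed along the
  way are defined on the whole space with one common norm bound \<open>K\<close>, but intertwine only on \<open>M n\<close>.
  They stabilise on the union \<open>U\<close> of these subspaces. The stable value is linear and bounded by \<open>K\<close>
  there, so it extends to the whole space, and density of \<open>U\<close> carries the intertwining relation over by
  continuity.\<close>

lemma intertwining_lift:
  fixes J :: "'h::chilbert_space \<Rightarrow> 'k::chilbert_space" and S :: "'h \<Rightarrow> 'h" and W :: "'k \<Rightarrow> 'k"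
    and V :: "'b::chilbert_space \<Rightarrow> 'b" and Z :: "'h \<Rightarrow> 'b"
  assumes ext: "minimal_coisometric_extension J S W"
    and V: "coisometry V" and Z: "bounded_clinear Z"
    and VZ: "\<And>h. V (Z h) = Z (S h)"
  shows "\<exists>Y. bounded_clinear Y \<and> (\<forall>k. V (Y k) = Y (W k)) \<and> (\<forall>h. Y (J h) = Z h) \<and>
           (\<forall>k. norm (Y k) \<le> onorm Z * norm k)"
proof -
  have emb: "hilbert_embedding J" and coW: "coisometry W" and WJ: "\<And>h. W (J h) = J (S h)"
    and dense: "closure (cspan {(cadjoint W ^^ n) (J h) | n h. True}) = UNIV"
    using ext by (auto simp: minimal_coisometric_extension_def coisometric_extension_def)
  note W = coisometry_bounded_clinear[OF coW]
  have J: "bounded_clinear J" using emb by (simp add: hilbert_embedding_def)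
  have normJ: "norm (J x) = norm x" for x by (rule hilbert_embedding_norm[OF emb])
  have "inj J"
    using normJ linear_diff[OF bounded_linear.linear[OF bounded_clinear_bounded_linear[OF J]]]
    by (intro injI) (metis norm_eq_zero right_minus_eq)
  define K where "K = onorm Z"
  have K: "0 \<le> K"
    unfolding K_def by (rule onorm_pos_le[OF bounded_clinear_bounded_linear[OF Z]])
  have Z_le: "norm (Z h) \<le> K * norm h" for h
    unfolding K_def by (rule onorm[OF bounded_clinear_bounded_linear[OF Z]])
  define M where "M n = (W ^^ n) -` range J" for n
  have M: "complex_vector.subspace (M n)" for n
    unfolding M_def by (intro subspace_vimage bounded_clinear_funpow W subspace_range J)
  have M_Suc: "W x \<in> M n" if "x \<in> M (Suc n)" for x n
    using that by (simp add: M_def funpow_swap1)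
  have M_step: "M n \<subseteq> M (Suc n)" for n
    using WJ by (auto simp: M_def)
  then have M_mono: "m \<le> n \<Longrightarrow> M m \<subseteq> M n" for m n
    by (rule lift_Suc_mono_le)
  have J_in_M: "J h \<in> M n" for h n
    using M_mono[of 0 n] by (auto simp: M_def)
  define extends where "extends n A \<longleftrightarrow> bounded_clinear A \<and> (\<forall>x. norm (A x) \<le> K * norm x) \<and>
      (\<forall>h. A (J h) = Z h) \<and> (\<forall>x\<in>M n. V (A x) = A (W x))" for n A
  have "\<exists>A. \<forall>n. extends n (A n) \<and> (\<forall>x\<in>M n. A (Suc n) x = A n x)"
  proof (rule dependent_nat_choice)
    \<comment> \<open>on \<open>M 0\<close>, the range of \<open>J\<close>, the operator is prescribed by \<open>Z\<close>\<close>
    let ?C = "\<lambda>x. Z (inv J x)"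
    have inv: "inv J (J h) = h" for h using \<open>inj J\<close> by simp
    have "\<exists>A. bounded_clinear A \<and> (\<forall>x\<in>range J. A x = ?C x) \<and> (\<forall>x. norm (A x) \<le> K * norm x)"
      by (rule bounded_extension[OF subspace_range[OF J] _ _ _ K])
        (auto simp: inv normJ Z_le bounded_clinear_add[OF Z] bounded_clinear_scaleC[OF Z]
          simp flip: bounded_clinear_add[OF J] bounded_clinear_scaleC[OF J])
    then show "\<exists>A. extends 0 A" by (auto simp: extends_def inv M_def WJ VZ)
  next
    fix A n assume A: "extends n A"
    then have "\<exists>B. bounded_clinear B \<and> (\<forall>x\<in>M n. B x = A x) \<and>
           (\<forall>x. norm (B x) \<le> K * norm x) \<and> (\<forall>x. V (B x) = A (W x))"
      by (intro intertwining_extension_step[OF V W coisometry_norm_le[OF coW] M _ _ K])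
        (auto simp: extends_def)
    then show "\<exists>B. extends (Suc n) B \<and> (\<forall>x\<in>M n. B x = A x)"
      using A J_in_M M_Suc unfolding extends_def by metis
  qed
  then obtain A where A: "\<And>n. extends n (A n)" and A_Suc: "\<And>n x. x \<in> M n \<Longrightarrow> A (Suc n) x = A n x"
    by blast
  have A_eq: "A n x = A m x" if "m \<le> n" "x \<in> M m" for m n x
    using that(1)
  proof (induction n rule: dec_induct)
    case (step n)
    then show ?case using A_Suc[of x n] M_mono[of m n] that(2) by auto
  qed simp
  define U where "U = (\<Union>n. M n)"
  have U2: "\<exists>n. x \<in> M n \<and> y \<in> M n" if "x \<in> U" "y \<in> U" for x y
  proof -
    obtain m n where "x \<in> M m" "y \<in> M n" using \<open>x \<in> U\<close> \<open>y \<in> U\<close> by (auto simp: U_def)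
    then show ?thesis using M_mono[of m "max m n"] M_mono[of n "max m n"] by auto
  qed
  have U: "complex_vector.subspace U"
    unfolding complex_vector.subspace_def
  proof (intro conjI allI ballI)
    show "0 \<in> U" using complex_vector.subspace_0[OF M] by (auto simp: U_def)
    show "x + y \<in> U" if "x \<in> U" "y \<in> U" for x y
      using U2[OF that] complex_vector.subspace_add[OF M] by (auto simp: U_def)
    show "c *\<^sub>C x \<in> U" if "x \<in> U" for c x
      using that complex_vector.subspace_scale[OF M] by (auto simp: U_def)
  qed
  have W_adj: "(W ^^ n) ((cadjoint W ^^ n) x) = x" for n x
  proof (induction n)
    case (Suc n)
    have "(W ^^ Suc n) ((cadjoint W ^^ Suc n) x) = (W ^^ n) (W (cadjoint W ((cadjoint W ^^ n) x)))"
      unfolding funpow_Suc_right[of n W] by simp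
    then show ?case using Suc by (simp only: coisometry_cadjoint_cancel[OF coW])
  qed simp
  have "{(cadjoint W ^^ n) (J h) | n h. True} \<subseteq> U"
  proof clarify
    fix n h
    have "(cadjoint W ^^ n) (J h) \<in> M n" by (simp add: M_def W_adj)
    then show "(cadjoint W ^^ n) (J h) \<in> U" by (auto simp: U_def)
  qed
  then have U_dense: "closure U = UNIV"
    using closure_mono[OF complex_vector.span_minimal[OF _ U]] dense by blast
  \<comment> \<open>the least index is only a choice: by \<open>A_eq\<close> any index with \<open>x \<in> M n\<close> gives the same value\<close>
  define C where "C x = A (LEAST n. x \<in> M n) x" for x
  have C_eq: "C x = A n x" if "x \<in> M n" for x n
    unfolding C_def by (rule A_eq[symmetric]) (rule Least_le LeastI, rule that)+
  have A_lin: "bounded_clinear (A n)" and A_le: "norm (A n x) \<le> K * norm x"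
    and AJ: "A n (J h) = Z h" and VA: "x \<in> M n \<Longrightarrow> V (A n x) = A n (W x)" for n x h
    using A by (auto simp: extends_def)
  have "\<exists>Y. bounded_clinear Y \<and> (\<forall>x\<in>U. Y x = C x) \<and> (\<forall>x. norm (Y x) \<le> K * norm x)"
  proof (rule bounded_extension[OF U _ _ _ K])
    fix x y and c :: complex
    assume x: "x \<in> U"
    then obtain n where n: "x \<in> M n" by (auto simp: U_def)
    show "C (c *\<^sub>C x) = c *\<^sub>C C x"
      using C_eq[OF n] C_eq[OF complex_vector.subspace_scale[OF M n]]
      by (simp add: bounded_clinear_scaleC[OF A_lin])
    show "norm (C x) \<le> K * norm x" using C_eq[OF n] A_le by simp
    assume "y \<in> U"
    then obtain n where n: "x \<in> M n" "y \<in> M n" using U2 x by blast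
    show "C (x + y) = C x + C y"
      using C_eq[OF n(1)] C_eq[OF n(2)] C_eq[OF complex_vector.subspace_add[OF M n]]
      by (simp add: bounded_clinear_add[OF A_lin])
  qed
  then obtain Y where Y: "bounded_clinear Y" "\<And>x. x \<in> U \<Longrightarrow> Y x = C x"
      "\<And>x. norm (Y x) \<le> K * norm x" by blast
  have Y_eq: "Y x = A n x" if "x \<in> M n" for x n
    using Y(2)[of x] C_eq[OF that] that by (auto simp: U_def)
  have "V (Y x) = Y (W x)" if "x \<in> U" for x
  proof -
    obtain n where n: "x \<in> M n" using \<open>x \<in> U\<close> by (auto simp: U_def)
    then have "W x \<in> M n" using M_step M_Suc by blast
    then show ?thesis using n by (simp add: Y_eq VA)
  qed
  moreover have "closed {x. V (Y x) = Y (W x)}"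
    using bounded_clinear_compose[OF coisometry_bounded_clinear[OF V] Y(1)]
      bounded_clinear_compose[OF Y(1) W]
    by (intro closed_Collect_eq linear_continuous_on bounded_clinear_bounded_linear)
  ultimately have "closure U \<subseteq> {x. V (Y x) = Y (W x)}"
    by (intro closure_minimal) auto
  then have "\<forall>k. V (Y k) = Y (W k)" using U_dense by blast
  moreover have "\<forall>h. Y (J h) = Z h" by (simp add: Y_eq[OF J_in_M[of _ 0]] AJ)
  ultimately show ?thesis using Y unfolding K_def by blast
qed

theorem theorem3p3:
  fixes T X :: "'h::chilbert_space \<Rightarrow> 'h"
    and q :: complex
    and J' :: "'h \<Rightarrow> 'k'::chilbert_space" and V :: "'k' \<Rightarrow> 'k'"
    and J :: "'h \<Rightarrow> 'k::chilbert_space" and V\<^sub>q :: "'k \<Rightarrow> 'k"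
  assumes "contraction T" and "T \<noteq> (\<lambda>h. 0)"
    and "bounded_clinear X"
    and "\<And>h. T (X h) = q *\<^sub>C X (T h)"
    and "0 < cmod q" and "cmod q \<le> 1 / onorm T"
    and "minimal_coisometric_extension J' T V"
    and "bounded_clinear V\<^sub>q"
    and "minimal_coisometric_extension J (\<lambda>h. q *\<^sub>C T h) (\<lambda>k. q *\<^sub>C V\<^sub>q k)"
  shows "\<exists>Y :: 'k \<Rightarrow> 'k'. bounded_clinear Y \<and>
           (\<forall>k. V (Y k) = q *\<^sub>C Y (V\<^sub>q k)) \<and>
           Y ` range J \<subseteq> range J' \<and>
           (\<forall>h. Y (J h) = J' (X h)) \<and>
           onorm X = onorm Y"
proof -
  note X = \<open>bounded_clinear X\<close>
  have embJ: "hilbert_embedding J" and embJ': "hilbert_embedding J'" and V: "coisometry V"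
    and VJ': "\<And>h. V (J' h) = J' (T h)"
    using assms(7,9) by (auto simp: minimal_coisometric_extension_def coisometric_extension_def)
  have normJ: "norm (J h) = norm h" and normJ': "norm (J' h) = norm h" for h
    using embJ embJ' by (simp_all add: hilbert_embedding_norm)
  have J': "bounded_clinear J'" using embJ' by (simp add: hilbert_embedding_def)
  have onorm_J'X: "onorm (\<lambda>h. J' (X h)) = onorm X"
    by (simp add: onorm_def normJ')
  obtain Y where Y: "bounded_clinear Y" "\<And>k. V (Y k) = Y (q *\<^sub>C V\<^sub>q k)"
      "\<And>h. Y (J h) = J' (X h)" "\<And>k. norm (Y k) \<le> onorm X * norm k"
    using intertwining_lift[OF assms(9) V bounded_clinear_compose[OF J' X]]
    by (auto simp: VJ' assms(4) bounded_clinear_scaleC[OF X] onorm_J'X)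
  \<comment> \<open>\<open>Y\<close> restricts to \<open>X\<close> up to the isometric embeddings, so its norm cannot be smaller\<close>
  have "onorm X \<le> onorm Y"
  proof (rule onorm_bound)
    fix h
    have "norm (X h) = norm (Y (J h))" by (simp add: Y(3) normJ')
    also have "\<dots> \<le> onorm Y * norm (J h)"
      by (rule onorm[OF bounded_clinear_bounded_linear[OF Y(1)]])
    finally show "norm (X h) \<le> onorm Y * norm h" by (simp add: normJ)
  qed (rule onorm_pos_le[OF bounded_clinear_bounded_linear[OF Y(1)]])
  moreover have "onorm Y \<le> onorm X"
    using Y(4) onorm_pos_le[OF bounded_clinear_bounded_linear[OF X]] by (intro onorm_bound)
  ultimately have "onorm X = onorm Y" by simp
  then show ?thesis using Y by (intro exI[of _ Y]) (auto simp: bounded_clinear_scaleC)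
qed

end
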